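(* Let $\mathbf{X}$ be an $n\times p$ real matrix of full column rank $p<n$ with one column equal to $\mathbf{1}_n$, and let $\mathbf{H}$ be the $n\times n$ neighborhood matrix described in the context, with spectral decomposition $\mathbf{H}=\mathbf{P}\mathbf{D}\mathbf{P}'$, where $\mathbf{P}$ is orthogonal and $\mathbf{D}=\mathrm{diag}(d_1,\dots,d_n)$, $d_1\ge\cdots\ge d_{n-1}>d_n=0$. Put $\mathbf{D}^+=\mathrm{diag}(d_1^{-1},\dots,d_{n-1}^{-1},0)$, $\mathbf{H}^+=\mathbf{P}\mathbf{D}^+\mathbf{P}'$, $\widetilde{\mathbf{X}}=\mathbf{P}'\mathbf{X}$, and, for $\tau>0$, $\mathbf{B}(\tau)=(\mathbf{I}_n+\tau^{-1}\mathbf{D}^+)^{-1}$ and $\mathbf{Q}_{ij}(\tau)=\widetilde{\mathbf{X}}'\{\mathbf{D}^+\}^{i}\{\mathbf{B}(\tau)\}^{j}\widetilde{\mathbf{X}}$ for nonnegative integers $i,j$ (with $\{\mathbf{D}^+\}^0=\mathbf{I}_n$). Let $\mathbf{G}=\mathbf{I}_n-\mathbf{X}(\mathbf{X}'\mathbf{X})^{-1}\mathbf{X}'$, let $\mathbf{M}^*$ be an $n\times(n-p)$ matrix whose columns are orthonormal eigenvectors of $\mathbf{G}$ corresponding to its nonzero eigenvalues, and let $\lambda_1\ge\cdots\ge\lambda_{n-p}$ be the eigenvalues of ${\mathbf{M}^*}'\mathbf{H}^+\mathbf{M}^*$. Then the marginal reference prior for $\tau\in(0,\infty)$ given by $$ \begin{aligned}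 \pi(\tau) \propto \tau^{-2}\Big\{ & \mathrm{tr}\big((\mathbf{D}^+\mathbf{B}(\tau))^2\big) + \mathrm{tr}\big((\{\mathbf{Q}_{01}(\tau)\}^{-1}\mathbf{Q}_{12}(\tau))^2\big) - 2\,\mathrm{tr}\big(\{\mathbf{Q}_{01}(\tau)\}^{-1}\mathbf{Q}_{23}(\tau)\big) \\ & - \frac{1}{n-p}\big[\mathrm{tr}(\{\mathbf{Q}_{01}(\tau)\}^{-1}\mathbf{Q}_{12}(\tau)) - \mathrm{tr}(\mathbf{D}^+\mathbf{B}(\tau))\big]^2 \Big\}^{1/2} \end{aligned} $$ is equivalent to the marginal reference prior for $\tau$ given by $$ \pi(\tau)\propto\frac{1}{\tau}\left[\sum_{j=1}^{n-p}\left(\frac{\lambda_j}{\tau+\lambda_j}\right)^2-\frac{1}{n-p}\left\{\sum_{j=1}^{n-p}\frac{\lambda_j}{\tau+\lambda_j}\right\}^2\right]^{1/2}, $$ that is, the two right-hand sides, as functions of $\tau\in(0,\infty)$, agree up to a positive multiplicative constant not depending on $\tau$.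
   Context: Neighborhood matrix. A region is partitioned into $n$ subregions; $N_j$ is the set of neighbors of subregion $j$ (a symmetric relation, $j\notin N_j$). Similarity weights satisfy $g_{ij}=g_{ji}\ge 0$, with $g_{ij}=0$ when $i\ne j$ are not neighbors. The symmetric $n\times n$ matrix $\mathbf{H}$ has entries $(\mathbf{H})_{ii}=h_i=\sum_{j\neq i}g_{ij}$, $(\mathbf{H})_{ij}=-g_{ij}$ if $i\in N_j$, and $0$ otherwise. Thus $\mathbf{H}$ is positive semidefinite and $\mathbf{H}\mathbf{1}_n=\mathbf{0}$. It is assumed that any two subregions are connected by a path, so that the null eigenvalue of $\mathbf{H}$ has multiplicity one. $\mathbf{H}^+$ is the Moore-Penrose inverse of $\mathbf{H}$. Primes denote transposes. Background. Both priors are for the parameter $\tau$ in the model $\mathbf{y}\sim N(\mathbf{X}\boldsymbol{\beta},\sigma^2(\mathbf{I}_n+\tau^{-1}\mathbf{H}^+))$. A prior is specified by a nonnegative function of $\tau$ up to a positive multiplicative constant, and "equivalent" means being the same prior in this sense. *)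

theory Defs
  imports
    "Jordan_Normal_Form.Char_Poly"
    "Jordan_Normal_Form.Gauss_Jordan_Elimination"
    "Jordan_Normal_Form.DL_Rank"
begin

text \<open>Subregions, rows, columns and eigenvalues are indexed from \<open>0\<close>; matrices are those of
  \<^theory>\<open>Jordan_Normal_Form.Matrix\<close>, with dimensions given by carrier sets.\<close>

definition trace_mat :: "'a :: comm_monoid_add mat \<Rightarrow> 'a" where
  "trace_mat A = (\<Sum>i < dim_row A. A $$ (i, i))"

text \<open>Unspecified when the matrix is not invertible.\<close>

definition inv_mat :: "'a :: field mat \<Rightarrow> 'a mat" where
  "inv_mat A = the (mat_inverse A)"

text \<open>\<open>N j\<close> is the set of neighbors of subregion \<open>j\<close> and \<open>g i j\<close> the similarity weight.
  The weight of a pair of neighbors may be zero, and paths run along the neighbor relation,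
  so connectedness alone does not make the null eigenvalue of the neighborhood matrix simple;
  that is part of \<open>spectral_decomp\<close> below.\<close>

definition neighborhood_system :: "nat \<Rightarrow> (nat \<Rightarrow> nat set) \<Rightarrow> (nat \<Rightarrow> nat \<Rightarrow> real) \<Rightarrow> bool" where
  "neighborhood_system n N g \<longleftrightarrow>
     (\<forall>j<n. N j \<subseteq> {..<n} \<and> j \<notin> N j) \<and>
     (\<forall>i<n. \<forall>j<n. i \<in> N j \<longleftrightarrow> j \<in> N i) \<and>
     (\<forall>i<n. \<forall>j<n. g i j = g j i \<and> 0 \<le> g i j) \<and>
     (\<forall>i<n. \<forall>j<n. i \<noteq> j \<and> i \<notin> N j \<longrightarrow> g i j = 0) \<and>
     (\<forall>i<n. \<forall>j<n. (i, j) \<in> {(a, b). a < n \<and> b < n \<and> a \<in> N b}\<^sup>*)"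

definition neighborhood_matrix ::
    "nat \<Rightarrow> (nat \<Rightarrow> nat set) \<Rightarrow> (nat \<Rightarrow> nat \<Rightarrow> real) \<Rightarrow> real mat" where
  "neighborhood_matrix n N g = mat n n (\<lambda>(i, j).
     if i = j then (\<Sum>k \<in> {..<n} - {i}. g i k) else if i \<in> N j then - g i j else 0)"

text \<open>Meant for \<open>n \<ge> 2\<close>, where the truncated \<open>n - 2\<close> is the last but one index.\<close>

definition spectral_decomp :: "nat \<Rightarrow> real mat \<Rightarrow> real mat \<Rightarrow> (nat \<Rightarrow> real) \<Rightarrow> bool" where
  "spectral_decomp n H P d \<longleftrightarrow>
     P \<in> carrier_mat n n \<and> transpose_mat P * P = 1\<^sub>m n \<and> P * transpose_mat P = 1\<^sub>m n \<and>
     H = P * mat_diag n d * transpose_mat P \<and>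
     (\<forall>i j. i \<le> j \<and> j < n \<longrightarrow> d j \<le> d i) \<and> d (n - 2) > d (n - 1) \<and> d (n - 1) = 0"

definition D_plus :: "nat \<Rightarrow> (nat \<Rightarrow> real) \<Rightarrow> real mat" where
  "D_plus n d = mat_diag n (\<lambda>i. if i < n - 1 then inverse (d i) else 0)"

definition H_plus :: "nat \<Rightarrow> real mat \<Rightarrow> (nat \<Rightarrow> real) \<Rightarrow> real mat" where
  "H_plus n P d = P * D_plus n d * transpose_mat P"

definition B_mat :: "nat \<Rightarrow> (nat \<Rightarrow> real) \<Rightarrow> real \<Rightarrow> real mat" where
  "B_mat n d \<tau> = inv_mat (1\<^sub>m n + inverse \<tau> \<cdot>\<^sub>m D_plus n d)"

definition Q_mat ::
    "nat \<Rightarrow> (nat \<Rightarrow> real) \<Rightarrow> real mat \<Rightarrow> real mat \<Rightarrow> nat \<Rightarrow> nat \<Rightarrow> real \<Rightarrow> real mat" where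
  "Q_mat n d P X i j \<tau> =
     (let Xt = transpose_mat P * X
      in transpose_mat Xt * (D_plus n d ^\<^sub>m i) * (B_mat n d \<tau> ^\<^sub>m j) * Xt)"

definition G_mat :: "nat \<Rightarrow> real mat \<Rightarrow> real mat" where
  "G_mat n X = 1\<^sub>m n - X * inv_mat (transpose_mat X * X) * transpose_mat X"

definition orthonormal_nonzero_eigenvectors :: "nat \<Rightarrow> nat \<Rightarrow> real mat \<Rightarrow> real mat \<Rightarrow> bool" where
  "orthonormal_nonzero_eigenvectors n m A M \<longleftrightarrow>
     M \<in> carrier_mat n m \<and> transpose_mat M * M = 1\<^sub>m m \<and>
     (\<forall>j<m. \<exists>\<mu>. \<mu> \<noteq> 0 \<and> eigenvector A (col M j) \<mu>)"

text \<open>\<open>lam 0 \<ge> \<dots> \<ge> lam (m - 1)\<close> lists the eigenvalues of the \<open>m \<times> m\<close> matrix \<open>A\<close>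
  with multiplicity.\<close>

definition ordered_eigenvalues :: "nat \<Rightarrow> real mat \<Rightarrow> (nat \<Rightarrow> real) \<Rightarrow> bool" where
  "ordered_eigenvalues m A lam \<longleftrightarrow>
     (\<forall>i j. i \<le> j \<and> j < m \<longrightarrow> lam j \<le> lam i) \<and>
     char_poly A = (\<Prod>i<m. [:- lam i, 1:])"

definition reference_prior_XD ::
    "nat \<Rightarrow> nat \<Rightarrow> real mat \<Rightarrow> real mat \<Rightarrow> (nat \<Rightarrow> real) \<Rightarrow> real \<Rightarrow> real" where
  "reference_prior_XD n p X P d \<tau> =
     (let DB = D_plus n d * B_mat n d \<tau>;
          Q = (\<lambda>i j. Q_mat n d P X i j \<tau>);
          R = inv_mat (Q 0 1) * Q 1 2
      in 1 / \<tau>\<^sup>2 *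
         sqrt (trace_mat (DB ^\<^sub>m 2) + trace_mat (R ^\<^sub>m 2) - 2 * trace_mat (inv_mat (Q 0 1) * Q 2 3)
               - 1 / real (n - p) * (trace_mat R - trace_mat DB)\<^sup>2))"

definition reference_prior_eigen :: "nat \<Rightarrow> (nat \<Rightarrow> real) \<Rightarrow> real \<Rightarrow> real" where
  "reference_prior_eigen m lam \<tau> =
     1 / \<tau> * sqrt ((\<Sum>j<m. (lam j / (\<tau> + lam j))\<^sup>2) - 1 / real m * (\<Sum>j<m. lam j / (\<tau> + lam j))\<^sup>2)"

text \<open>A prior on \<open>(0, \<infinity>)\<close> is a nonnegative function up to a positive multiplicative constant.
  Nonnegativity is stated because the library's square root is negative on negative arguments.\<close>

definition equivalent_priors :: "(real \<Rightarrow> real) \<Rightarrow> (real \<Rightarrow> real) \<Rightarrow> bool" where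
  "equivalent_priors f g \<longleftrightarrow>
     (\<forall>\<tau>>0. 0 \<le> f \<tau>) \<and> (\<forall>\<tau>>0. 0 \<le> g \<tau>) \<and> (\<exists>c>0. \<forall>\<tau>>0. f \<tau> = c * g \<tau>)"

end

theory Submission
  imports Defs "Jordan_Normal_Form.Schur_Decomposition"
begin

text \<open>Put \<open>S = I + D\<^sup>+/\<tau> = B\<^sup>-\<^sup>1\<close>, \<open>Y = P'X\<close>, \<open>Z = P'M\<^sup>*\<close>. The columns of \<open>Z\<close> are an orthonormal
  basis of the orthogonal complement of the columns of \<open>Y\<close>, so the matrix
  \<open>W = B - B Y Q\<^sub>0\<^sub>1\<^sup>-\<^sup>1 Y'B\<close>, which annihilates \<open>Y\<close> on both sides, equals \<open>Z (Z'SZ)\<^sup>-\<^sup>1 Z'\<close>.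
  Expanding \<open>tr ((D\<^sup>+W)\<^sup>k)\<close> for \<open>k = 1, 2\<close> with the first formula for \<open>W\<close> gives the traces of the
  first prior; with the second it is \<open>tr ((A (I + A/\<tau>)\<^sup>-\<^sup>1)\<^sup>k)\<close> for \<open>A = Z'D\<^sup>+Z = M\<^sup>*'H\<^sup>+M\<^sup>*\<close>,
  that is the sum of the \<open>(\<tau> \<lambda>\<^sub>j/(\<tau> + \<lambda>\<^sub>j))\<^sup>k\<close>. Hence the two priors are equal, with
  constant \<open>1\<close>.\<close>

section \<open>Matrix algebra with computable dimensions\<close>

text \<open>Side conditions on \<open>dim_row\<close> and \<open>dim_col\<close> mention no
  dimension variables to be guessed, so simp can discharge them and normalize long products of
  rectangular matrices.\<close>

lemma mult_assoc_dim:
  fixes A B C :: "'a :: semiring_0 mat"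
  assumes "dim_col A = dim_row B" "dim_col B = dim_row C"
  shows "A * B * C = A * (B * C)"
  using assms by (intro assoc_mult_mat) auto

lemma transpose_mult_dim:
  fixes A B :: "'a :: comm_semiring_0 mat"
  assumes "dim_col A = dim_row B"
  shows "transpose_mat (A * B) = transpose_mat B * transpose_mat A"
  using assms by (intro transpose_mult) auto

lemma minus_mult_dim:
  fixes A B C :: "'a :: ring mat"
  assumes "dim_row A = dim_row B" "dim_col A = dim_col B" "dim_col B = dim_row C"
  shows "(A - B) * C = A * C - B * C"
  using assms by (intro minus_mult_distrib_mat) auto

lemma mult_minus_dim:
  fixes A B C :: "'a :: ring mat"
  assumes "dim_row B = dim_row C" "dim_col B = dim_col C" "dim_col A = dim_row B"
  shows "A * (B - C) = A * B - A * C"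
  using assms by (intro mult_minus_distrib_mat) auto

lemma add_zero_dim:
  "dim_row A = n \<Longrightarrow> dim_col A = m \<Longrightarrow> A + 0\<^sub>m n m = (A :: 'a :: monoid_add mat)"
  by auto

lemma minus_zero_dim:
  "dim_row A = n \<Longrightarrow> dim_col A = m \<Longrightarrow> A - 0\<^sub>m n m = (A :: 'a :: group_add mat)"
  by auto

lemma trace_mult_comm:
  fixes A B :: "'a :: comm_semiring_0 mat"
  assumes "dim_col A = dim_row B" "dim_col B = dim_row A"
  shows "trace_mat (A * B) = trace_mat (B * A)"
proof -
  have "trace_mat (A * B) = (\<Sum>i<dim_row A. \<Sum>k<dim_row B. A $$ (i, k) * B $$ (k, i))"
    using assms by (simp add: trace_mat_def scalar_prod_def atLeast0LessThan)
  also have "\<dots> = (\<Sum>k<dim_row B. \<Sum>i<dim_row A. B $$ (k, i) * A $$ (i, k))"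
    by (subst sum.swap) (simp add: mult.commute)
  also have "\<dots> = trace_mat (B * A)"
    using assms by (simp add: trace_mat_def scalar_prod_def atLeast0LessThan)
  finally show ?thesis .
qed

lemma trace_minus:
  "dim_row A = dim_row B \<Longrightarrow> dim_col A = dim_row A \<Longrightarrow> dim_col B = dim_row B \<Longrightarrow>
    trace_mat (A - B) = trace_mat A - trace_mat (B :: 'a :: ab_group_add mat)"
  by (simp add: trace_mat_def sum_subtractf)

lemma trace_one: "trace_mat (1\<^sub>m n :: 'a :: semiring_1 mat) = of_nat n"
  by (simp add: trace_mat_def)

lemma pow_mat_2: "A ^\<^sub>m 2 = (A :: 'a :: semiring_1 mat) * A" if "A \<in> carrier_mat n n"
  using that by (simp add: numeral_2_eq_2)

lemma pow_mat_3: "A ^\<^sub>m 3 = (A :: 'a :: semiring_1 mat) * A * A" if "A \<in> carrier_mat n n"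
  using that by (simp add: numeral_3_eq_3)

text \<open>For such an \<open>E\<close> the trace equals the trace of E'E, which is the sum of the
  squared entries.\<close>

lemma symmetric_idempotent_trace_0:
  fixes E :: "real mat"
  assumes E: "E \<in> carrier_mat n n" and sym: "transpose_mat E = E" and idem: "E * E = E"
    and tr: "trace_mat E = 0"
  shows "E = 0\<^sub>m n n"
proof -
  have "trace_mat (transpose_mat E * E) = (\<Sum>i<n. \<Sum>k<n. (E $$ (k, i))\<^sup>2)"
    using E by (simp add: trace_mat_def scalar_prod_def atLeast0LessThan power2_eq_square)
  then have "(\<Sum>i<n. \<Sum>k<n. (E $$ (k, i))\<^sup>2) = 0"
    using sym idem tr by simp
  then have "\<forall>i<n. \<forall>k<n. E $$ (k, i) = 0"
    by (auto simp: sum_nonneg_eq_0_iff sum_nonneg)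
  then show ?thesis using E by auto
qed

section \<open>Inverses\<close>

text \<open>Evaluates the \<open>the\<close> in \<open>inv_mat\<close>: a one-sided inverse of a
  square matrix is two-sided, so \<open>A\<close> is a unit and \<open>mat_inverse\<close> cannot
  return \<open>None\<close>.\<close>

lemma inv_mat_eqI:
  fixes A B :: "'a :: field mat"
  assumes A: "A \<in> carrier_mat n n" and B: "B \<in> carrier_mat n n" and AB: "A * B = 1\<^sub>m n"
  shows "inv_mat A = B"
proof -
  have BA: "B * A = 1\<^sub>m n" using mat_mult_left_right_inverse[OF A B AB] .
  show ?thesis
  proof (cases "mat_inverse A")
    case None
    then have "A \<notin> Units (ring_mat TYPE('a) n ())" using mat_inverse(1)[OF A, where b = "()"] by blast
    moreover have "A \<in> Units (ring_mat TYPE('a) n ())"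
      using A B AB BA by (auto simp: Units_def ring_mat_def)
    ultimately show ?thesis by blast
  next
    case (Some C)
    from mat_inverse(2)[OF A Some] have C: "C * A = 1\<^sub>m n" "C \<in> carrier_mat n n" by auto
    have "C = C * (A * B)" unfolding AB using C(2) by simp
    also have "\<dots> = C * A * B" using A B C(2) by simp
    also have "\<dots> = B" using B C by simp
    finally show ?thesis by (simp add: inv_mat_def Some)
  qed
qed

lemma inv_mat_inverse:
  fixes A :: "'a :: field mat"
  assumes A: "A \<in> carrier_mat n n" and ker: "\<And>v. v \<in> carrier_vec n \<Longrightarrow> A *\<^sub>v v = 0\<^sub>v n \<Longrightarrow> v = 0\<^sub>v n"
  shows "inv_mat A \<in> carrier_mat n n" "A * inv_mat A = 1\<^sub>m n" "inv_mat A * A = 1\<^sub>m n"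
proof -
  have "det A \<noteq> 0" using det_0_iff_vec_prod_zero_field[OF A] ker by blast
  then have "A \<in> Units (ring_mat TYPE('a) n ())" using det_non_zero_imp_unit[OF A, where b = "()"] by blast
  then obtain C where "mat_inverse A = Some C"
    using mat_inverse(1)[OF A, where b = "()"] by (cases "mat_inverse A") auto
  with mat_inverse(2)[OF A this]
  show "inv_mat A \<in> carrier_mat n n" "A * inv_mat A = 1\<^sub>m n" "inv_mat A * A = 1\<^sub>m n"
    by (auto simp: inv_mat_def)
qed

lemma scalar_prod_mat_diag:
  fixes v :: "real vec"
  assumes "v \<in> carrier_vec n"
  shows "v \<bullet> (mat_diag n b *\<^sub>v v) = (\<Sum>i<n. b i * (v $ i)\<^sup>2)"
proof -
  have "(mat_diag n b *\<^sub>v v) $ i = b i * v $ i" if "i < n" for i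
  proof -
    have "(mat_diag n b *\<^sub>v v) $ i = (\<Sum>k<n. (if i = k then b k else 0) * v $ k)"
      using assms that by (simp add: mat_diag_def scalar_prod_def atLeast0LessThan)
    also have "\<dots> = (\<Sum>k<n. if i = k then b k * v $ k else 0)" by (intro sum.cong) auto
    finally show ?thesis using that by simp
  qed
  moreover have "dim_vec (mat_diag n b *\<^sub>v v) = n" by (simp add: mat_diag_def)
  ultimately show ?thesis
    using assms by (simp add: scalar_prod_def power2_eq_square ac_simps atLeast0LessThan)
qed

lemma scalar_prod_congruence:
  fixes Y A :: "real mat"
  assumes "Y \<in> carrier_mat n m" "A \<in> carrier_mat n n" "v \<in> carrier_vec m"
  shows "v \<bullet> ((transpose_mat Y * A * Y) *\<^sub>v v) = (Y *\<^sub>v v) \<bullet> (A *\<^sub>v (Y *\<^sub>v v))"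
proof -
  have "(transpose_mat Y * A * Y) *\<^sub>v v = transpose_mat Y *\<^sub>v (A *\<^sub>v (Y *\<^sub>v v))"
    using assms by (simp add: assoc_mult_mat_vec[of _ m n _ m] assoc_mult_mat_vec[of _ m n _ n])
  then show ?thesis
    using assms transpose_vec_mult_scalar[of Y n m v "A *\<^sub>v (Y *\<^sub>v v)"]
    by (metis mult_mat_vec_carrier comm_scalar_prod transpose_carrier_mat)
qed

text \<open>Positive definiteness: v'Av is the sum of b_i (Yv)_i^2, so Av = 0 forces Yv = 0. This
  serves both X'X (unit weights) and Y'BY.\<close>

lemma congruence_diag_inverse:
  fixes Y :: "real mat"
  assumes Y: "Y \<in> carrier_mat n m" and b: "\<And>i. i < n \<Longrightarrow> 0 < b i"
    and inj: "\<And>v. v \<in> carrier_vec m \<Longrightarrow> Y *\<^sub>v v = 0\<^sub>v n \<Longrightarrow> v = 0\<^sub>v m"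
  defines "A \<equiv> transpose_mat Y * mat_diag n b * Y"
  shows "inv_mat A \<in> carrier_mat m m" "A * inv_mat A = 1\<^sub>m m" "inv_mat A * A = 1\<^sub>m m"
proof -
  have A: "A \<in> carrier_mat m m" unfolding A_def using Y by auto
  have ker: "v = 0\<^sub>v m" if v: "v \<in> carrier_vec m" and Av: "A *\<^sub>v v = 0\<^sub>v m" for v
  proof -
    have Yv: "Y *\<^sub>v v \<in> carrier_vec n" using Y v by auto
    have "(\<Sum>i<n. b i * ((Y *\<^sub>v v) $ i)\<^sup>2) = v \<bullet> (A *\<^sub>v v)"
      unfolding A_def scalar_prod_congruence[OF Y mat_diag_dim v] scalar_prod_mat_diag[OF Yv] ..
    also have "\<dots> = 0" using v Av by simp
    finally have "\<forall>i<n. b i * ((Y *\<^sub>v v) $ i)\<^sup>2 = 0"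
      by (subst (asm) sum_nonneg_eq_0_iff) (auto intro!: mult_nonneg_nonneg less_imp_le[OF b])
    then have "\<forall>i<n. (Y *\<^sub>v v) $ i = 0" using b by fastforce
    then have "Y *\<^sub>v v = 0\<^sub>v n"
      using carrier_vecD[OF Yv] by (intro eq_vecI) (simp_all del: dim_mult_mat_vec index_mult_mat_vec)
    then show ?thesis using inj v by blast
  qed
  show "inv_mat A \<in> carrier_mat m m" "A * inv_mat A = 1\<^sub>m m" "inv_mat A * A = 1\<^sub>m m"
    using inv_mat_inverse[OF A ker] by auto
qed

text \<open>Independence is a property of the set of columns, so repeated columns are excluded
  first: they would leave fewer than \<open>nc\<close> distinct columns, while the rank is the size
  of a maximal independent subset of them.\<close>

lemma (in vec_space) full_rank_injective:
  assumes A: "A \<in> carrier_mat n nc" and r: "rank A = nc"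
    and v: "v \<in> carrier_vec nc" "A *\<^sub>v v = 0\<^sub>v n"
  shows "v = 0\<^sub>v nc"
proof -
  have dist: "distinct (cols A)"
  proof (rule ccontr)
    assume nd: "\<not> distinct (cols A)"
    obtain S where S: "maximal S (\<lambda>T. T \<subseteq> set (cols A) \<and> lin_indpt T)"
      using maximal_exists[of "(\<lambda>T. T \<subseteq> set (cols A) \<and> lin_indpt T)" "card (set (cols A))" "{}"]
      by (meson List.finite_set card_mono empty_iff empty_subsetI finite_lin_indpt2 rev_finite_subset)
    then have "card S \<le> card (set (cols A))" by (simp add: card_mono maximal_def)
    also have "\<dots> < length (cols A)"
      using nd card_distinct card_length le_neq_implies_less by blast
    finally show False using rank_card_indpt[OF A S] r A by simp
  qed
  show ?thesis
    using full_rank_lin_indpt[OF A r dist] lin_depI[OF A v(1) _ v(2) dist] by blast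
qed

section \<open>Traces from eigenvalues\<close>

text \<open>Back substitution from the last row upwards: once the entries of column \<open>j\<close>
  below row \<open>i\<close> vanish, entry (i, j) of LR reduces to L_ii R_ij. Hence the induction on
  \<open>n - i\<close>.\<close>

lemma upper_triangular_right_inverse:
  fixes L R :: "'a :: field mat"
  assumes L: "L \<in> carrier_mat n n" "upper_triangular L" and nz: "\<And>i. i < n \<Longrightarrow> L $$ (i, i) \<noteq> 0"
    and R: "R \<in> carrier_mat n n" and LR: "L * R = 1\<^sub>m n"
  shows "upper_triangular R"
proof -
  have "R $$ (i, j) = 0" if "j < i" "i < n" for i j
    using that
  proof (induction "n - i" arbitrary: i rule: less_induct)
    case less
    have "(\<Sum>k<n. L $$ (i, k) * R $$ (k, j)) = (L * R) $$ (i, j)"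
      using L R less.prems by (simp add: scalar_prod_def atLeast0LessThan)
    also have "\<dots> = 0" using LR less.prems by simp
    also have "(\<Sum>k<n. L $$ (i, k) * R $$ (k, j)) = (\<Sum>k<n. if k = i then L $$ (i, i) * R $$ (i, j) else 0)"
    proof (intro sum.cong refl)
      fix k assume k: "k \<in> {..<n}"
      consider "k < i" | "k = i" | "i < k" by linarith
      then show "L $$ (i, k) * R $$ (k, j) = (if k = i then L $$ (i, i) * R $$ (i, j) else 0)"
      proof cases
        case 1
        then show ?thesis using upper_triangularD[OF L(2) 1] L less.prems by simp
      next
        case 3
        then have "R $$ (k, j) = 0" using less.hyps[of k] less.prems k by auto
        then show ?thesis using 3 by simp
      qed auto
    qed
    finally show ?case using nz less.prems by simp
  qed
  then show ?thesis using R by (auto simp: upper_triangular_def)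
qed

lemma upper_triangular_mult:
  fixes S T :: "'a :: semiring_0 mat"
  assumes S: "S \<in> carrier_mat n n" "upper_triangular S" and T: "T \<in> carrier_mat n n" "upper_triangular T"
  shows "upper_triangular (S * T)" "i < n \<Longrightarrow> (S * T) $$ (i, i) = S $$ (i, i) * T $$ (i, i)"
proof -
  have e: "(S * T) $$ (i, j) = (\<Sum>k<n. S $$ (i, k) * T $$ (k, j))" if "i < n" "j < n" for i j
    using S T that by (simp add: scalar_prod_def atLeast0LessThan)
  show "upper_triangular (S * T)"
  proof (unfold upper_triangular_def, intro allI impI)
    fix i j assume "i < dim_row (S * T)" "j < i"
    then have ij: "i < n" "j < n" "j < i" using S by auto
    have "S $$ (i, k) * T $$ (k, j) = 0" if "k < n" for k
      using upper_triangularD[OF S(2), of k i] upper_triangularD[OF T(2), of j k] S T ij that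
      by (cases "k < i") auto
    then show "(S * T) $$ (i, j) = 0" by (simp add: e ij)
  qed
  assume i: "i < n"
  have "S $$ (i, k) * T $$ (k, i) = (if k = i then S $$ (i, i) * T $$ (i, i) else 0)" if "k < n" for k
    using upper_triangularD[OF S(2), of k i] upper_triangularD[OF T(2), of i k] S T i that
    by (cases k i rule: linorder_cases) auto
  then have "(\<Sum>k<n. S $$ (i, k) * T $$ (k, i)) = (\<Sum>k<n. if k = i then S $$ (i, i) * T $$ (i, i) else 0)"
    by (intro sum.cong) auto
  then show "(S * T) $$ (i, i) = S $$ (i, i) * T $$ (i, i)" using i by (simp add: e del: index_mult_mat)
qed

text \<open>\<open>K\<close> is the inverse of 1 + cA. A Schur form makes \<open>A\<close> and
  \<open>K\<close> simultaneously triangular; diagonals of triangular matrices multiply entrywise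
  and traces are invariant under similarity.\<close>

lemma trace_resolvent:
  fixes A K :: "real mat"
  assumes A: "A \<in> carrier_mat m m" and cp: "char_poly A = (\<Prod>i<m. [:- lam i, 1:])"
    and K: "K \<in> carrier_mat m m" and inv: "(1\<^sub>m m + c \<cdot>\<^sub>m A) * K = 1\<^sub>m m"
    and nz: "\<And>i. i < m \<Longrightarrow> 1 + c * lam i \<noteq> 0"
  shows "trace_mat (A * K) = (\<Sum>i<m. lam i / (1 + c * lam i))"
    and "trace_mat (A * K * (A * K)) = (\<Sum>i<m. (lam i / (1 + c * lam i))\<^sup>2)"
proof -
  define es where "es = map lam [0..<m]"
  have "char_poly A = (\<Prod>e\<leftarrow>es. [:- e, 1:])"
    unfolding cp es_def map_map o_def by (simp add: prod.list_conv_set_nth atLeast0LessThan)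
  \<comment> \<open>The Schur form lists the given roots on the diagonal of \<open>T\<close> in the
    given order.\<close>
  then obtain T U V where T: "similar_mat_wit A T U V" "upper_triangular T" "diag_mat T = es"
    using schur_decomposition[OF A] by (metis prod_cases3)
  note w = similar_mat_witD2[OF A T(1)]
  have dT: "T $$ (i, i) = lam i" if "i < m" for i
  proof -
    have "T $$ (i, i) = diag_mat T ! i" using that w by (simp add: diag_mat_def)
    then show ?thesis using that by (simp add: T(3) es_def)
  qed
  define L where "L = 1\<^sub>m m + c \<cdot>\<^sub>m T"
  define R where "R = V * K * U"
  have L: "L \<in> carrier_mat m m" and R: "R \<in> carrier_mat m m"
    using w K by (auto simp: L_def R_def)
  have uL: "upper_triangular L"
    using upper_triangularD[OF T(2)] w by (auto simp: L_def upper_triangular_def)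
  have dL: "L $$ (i, i) = 1 + c * lam i" if "i < m" for i
    using that w dT by (simp add: L_def)
  have d: "dim_row A = m" "dim_col A = m" "dim_row K = m" "dim_col K = m" "dim_row T = m" "dim_col T = m"
    "dim_row U = m" "dim_col U = m" "dim_row V = m" "dim_col V = m"
    using w K by auto
  \<comment> \<open>\<open>V\<close> intertwines 1 + cA with its triangular form \<open>L\<close>;
    this makes the conjugate \<open>R\<close> of \<open>K\<close> a right inverse of
    \<open>L\<close>.\<close>
  have VA: "V * (1\<^sub>m m + c \<cdot>\<^sub>m A) = L * V"
  proof -
    have "V * A = V * U * (T * V)" using w(3) by (simp add: mult_assoc_dim d)
    also have "\<dots> = T * V" using w by simp
    finally have "V * A = T * V" .
    then have "V * (c \<cdot>\<^sub>m A) = (c \<cdot>\<^sub>m T) * V"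
      using w by (simp add: mult_smult_distrib[of _ m m _ m] mult_smult_assoc_mat[of _ m m _ m])
    then show ?thesis
      using w by (simp add: L_def mult_add_distrib_mat[of _ m m _ m] add_mult_distrib_mat[of _ m m _ _ m])
  qed
  have "L * R = L * V * (K * U)" using L by (simp add: R_def mult_assoc_dim d)
  also have "\<dots> = V * ((1\<^sub>m m + c \<cdot>\<^sub>m A) * K) * U"
    using L by (simp add: VA[symmetric] mult_assoc_dim d)
  also have "\<dots> = 1\<^sub>m m" unfolding inv using w(2,7) by simp
  finally have LR: "L * R = 1\<^sub>m m" .
  have uR: "upper_triangular R"
    using upper_triangular_right_inverse[OF L uL _ R LR] dL nz by simp
  have dR: "R $$ (i, i) = 1 / (1 + c * lam i)" if "i < m" for i
  proof -
    have "(1 + c * lam i) * R $$ (i, i) = 1"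
      using upper_triangular_mult(2)[OF L uL R uR that] LR dL that by simp
    then show ?thesis using nz[OF that] by (simp add: field_simps)
  qed
  define Z where "Z = T * R"
  have Z: "Z \<in> carrier_mat m m" "upper_triangular Z"
    using w R upper_triangular_mult(1)[OF w(5) T(2) R uR] by (auto simp: Z_def)
  have dZ: "Z $$ (i, i) = lam i / (1 + c * lam i)" if "i < m" for i
    using upper_triangular_mult(2)[OF w(5) T(2) R uR that] dT dR that by (simp add: Z_def)
  have VU: "V * (U * Y) = Y" if "Y \<in> carrier_mat m k" for Y k
    using that w by (simp flip: assoc_mult_mat[of V m m U m Y k])
  have AK: "A * K = U * (Z * V)"
  proof -
    have "U * (Z * V) = U * (T * (V * (K * (U * V))))"
      by (simp add: Z_def R_def mult_assoc_dim d)
    also have "\<dots> = (U * T * V) * K" using w K by (simp add: mult_assoc_dim d)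
    finally show ?thesis using w(3) by simp
  qed
  have dZd: "dim_row Z = m" "dim_col Z = m" using Z by auto
  have "trace_mat (A * K) = trace_mat (Z * (V * U))"
    unfolding AK by (subst trace_mult_comm) (auto simp: d dZd mult_assoc_dim)
  also have "\<dots> = trace_mat Z" using w Z by simp
  also have "\<dots> = (\<Sum>i<m. lam i / (1 + c * lam i))"
    by (simp add: trace_mat_def dZd dZ)
  finally show "trace_mat (A * K) = (\<Sum>i<m. lam i / (1 + c * lam i))" .
  have "A * K * (A * K) = U * (Z * (V * (U * (Z * V))))"
    unfolding AK by (simp add: d dZd mult_assoc_dim)
  also have "\<dots> = U * (Z * (Z * V))" using w Z by (subst VU[of _ m]) auto
  finally have "trace_mat (A * K * (A * K)) = trace_mat (U * (Z * (Z * V)))" by simp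
  also have "\<dots> = trace_mat (Z * Z * (V * U))"
    by (subst trace_mult_comm) (auto simp: d dZd mult_assoc_dim)
  also have "\<dots> = trace_mat (Z * Z)" using w Z by simp
  also have "\<dots> = (\<Sum>i<m. (lam i / (1 + c * lam i))\<^sup>2)"
    using upper_triangular_mult(2)[OF Z Z]
    by (simp add: trace_mat_def dZd dZ power2_eq_square del: index_mult_mat(1))
  finally show "trace_mat (A * K * (A * K)) = (\<Sum>i<m. (lam i / (1 + c * lam i))\<^sup>2)" .
qed

section \<open>Compression to the orthogonal complement of the regressors\<close>

text \<open>In the application \<open>S\<close> is I + D/\<tau> and \<open>R\<close> is the inverse
  of X'X, so that ZZ' and YRY' are complementary orthogonal projections. The relation between
  \<open>S\<close> and \<open>D\<close> enters only after the interpretation.\<close>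

locale complementary_frames =
  fixes n p m :: nat and Y Z R S B D Q :: "real mat"
  assumes carrier: "Y \<in> carrier_mat n p" "Z \<in> carrier_mat n m" "R \<in> carrier_mat p p"
      "S \<in> carrier_mat n n" "B \<in> carrier_mat n n" "D \<in> carrier_mat n n" "Q \<in> carrier_mat p p"
    and ZZ: "transpose_mat Z * Z = 1\<^sub>m m" and YZ: "transpose_mat Y * Z = 0\<^sub>m p m"
    and resolution: "Z * transpose_mat Z + Y * R * transpose_mat Y = 1\<^sub>m n"
    and BS: "B * S = 1\<^sub>m n" and BD: "B * D = D * B"
    and Q: "Q * (transpose_mat Y * B * Y) = 1\<^sub>m p" "transpose_mat Y * B * Y * Q = 1\<^sub>m p"
begin

text \<open>With \<open>S\<close> as covariance and \<open>Y\<close> as design, this is the matrix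
  of the generalized least squares residual quadratic form, as in the restricted likelihood.\<close>

definition "W = B - B * Y * Q * transpose_mat Y * B"
definition "A = transpose_mat Z * D * Z"
definition "K = transpose_mat Z * W * Z"
definition "Q12 = transpose_mat Y * D * (B * B) * Y"
definition "Q23 = transpose_mat Y * (D * D) * (B * B * B) * Y"

lemma dims [simp]: "dim_row Y = n" "dim_col Y = p" "dim_row Z = n" "dim_col Z = m"
  "dim_row R = p" "dim_col R = p" "dim_row S = n" "dim_col S = n" "dim_row B = n" "dim_col B = n"
  "dim_row D = n" "dim_col D = n" "dim_row Q = p" "dim_col Q = p" "dim_row W = n" "dim_col W = n"
  using carrier by (auto simp: W_def)

lemma carriers [simp]: "A \<in> carrier_mat m m" "K \<in> carrier_mat m m" "W \<in> carrier_mat n n"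
  by (rule carrier_matI; simp add: A_def K_def)+

text \<open>As a rewrite rule on right-nested products this moves every \<open>D\<close> in front of
  every \<open>B\<close>, the order used in \<open>Q12\<close> and \<open>Q23\<close>.\<close>

lemma BD_assoc: "dim_row C = n \<Longrightarrow> B * (D * C) = D * (B * C)"
  using mult_assoc_dim[of B D C] mult_assoc_dim[of D B C] BD by simp

lemma W_mult_Y: "W * Y = 0\<^sub>m n p"
proof -
  have "W * Y = B * Y - B * Y * (Q * (transpose_mat Y * B * Y))"
    by (simp add: W_def minus_mult_dim mult_assoc_dim)
  also have "\<dots> = 0\<^sub>m n p" unfolding Q using carrier by simp
  finally show ?thesis .
qed

lemma Y_mult_W: "transpose_mat Y * W = 0\<^sub>m p n"
proof -
  have "transpose_mat Y * W = transpose_mat Y * B - (transpose_mat Y * B * Y * Q) * (transpose_mat Y * B)"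
    by (simp add: W_def mult_minus_dim mult_assoc_dim)
  also have "\<dots> = 0\<^sub>m p n" unfolding Q using carrier by simp
  finally show ?thesis .
qed

text \<open>Insert \<open>resolution\<close> after \<open>W\<close>; the \<open>Y\<close> part dies
  by \<open>W_mult_Y\<close>.\<close>

lemma W_ZZ: "W * (Z * transpose_mat Z) = W"
proof -
  have "W = W * (Z * transpose_mat Z + Y * R * transpose_mat Y)"
    by (simp add: resolution)
  also have "\<dots> = W * (Z * transpose_mat Z) + W * Y * (R * transpose_mat Y)"
    using carrier by (subst mult_add_distrib_mat[of _ n n _ n]) (auto simp: mult_assoc_dim)
  also have "\<dots> = W * (Z * transpose_mat Z)"
    using carrier by (simp add: W_mult_Y add_zero_dim)
  finally show ?thesis ..
qed

lemma ZZ_W: "Z * transpose_mat Z * W = W"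
proof -
  have "W = (Z * transpose_mat Z + Y * R * transpose_mat Y) * W"
    by (simp add: resolution)
  also have "\<dots> = Z * transpose_mat Z * W + Y * R * (transpose_mat Y * W)"
    using carrier by (subst add_mult_distrib_mat[of _ n n _ _ n]) (auto simp: mult_assoc_dim)
  also have "\<dots> = Z * transpose_mat Z * W"
    using carrier by (simp add: Y_mult_W add_zero_dim)
  finally show ?thesis ..
qed

text \<open>Since BS = 1 and Y'Z = 0, WSZ = Z. Absorbing ZZ' into \<open>W\<close> then gives
  K(Z'SZ) = Z'WSZ = Z'Z = 1, and a left inverse of a square matrix is also a right inverse.\<close>

lemma K_inverse: "transpose_mat Z * S * Z * K = 1\<^sub>m m"
proof (rule mat_mult_left_right_inverse)
  have "W * S = 1\<^sub>m n - B * Y * Q * transpose_mat Y * (B * S)"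
    unfolding W_def by (simp add: minus_mult_dim mult_assoc_dim BS)
  then have "W * S * Z = Z - B * Y * Q * (transpose_mat Y * Z)"
    using carrier by (simp add: BS minus_mult_dim mult_assoc_dim)
  then have WSZ: "W * S * Z = Z"
    unfolding YZ using carrier by (simp add: mult_assoc_dim minus_zero_dim)
  have "K * (transpose_mat Z * S * Z) = transpose_mat Z * (W * (Z * transpose_mat Z) * S * Z)"
    by (simp add: K_def mult_assoc_dim)
  then show "K * (transpose_mat Z * S * Z) = 1\<^sub>m m"
    by (simp only: W_ZZ WSZ ZZ)
qed (use carrier in auto)

lemma A_mult_K: "A * K = transpose_mat Z * (D * W * Z)"
proof -
  have "A * K = transpose_mat Z * (D * (Z * transpose_mat Z * W) * Z)"
    by (simp add: A_def K_def mult_assoc_dim)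
  then show ?thesis by (simp only: ZZ_W)
qed

text \<open>Cyclicity brings \<open>Z\<close> and Z' together next to \<open>W\<close>, which
  absorbs them; what remains is the trace of DW, expanded by the definition of
  \<open>W\<close>.\<close>

lemma trace_AK: "trace_mat (A * K) = trace_mat (D * B) - trace_mat (Q * Q12)"
proof -
  have "trace_mat (A * K) = trace_mat (D * (W * (Z * transpose_mat Z)))"
    unfolding A_mult_K by (subst trace_mult_comm) (simp_all add: mult_assoc_dim)
  also have "\<dots> = trace_mat (D * B - (D * B * Y) * (Q * transpose_mat Y * B))"
    unfolding W_ZZ by (simp add: W_def mult_minus_dim mult_assoc_dim)
  also have "\<dots> = trace_mat (D * B) - trace_mat ((D * B * Y) * (Q * transpose_mat Y * B))"
    by (rule trace_minus) auto
  also have "trace_mat ((D * B * Y) * (Q * transpose_mat Y * B)) = trace_mat (Q * Q12)"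
    by (subst trace_mult_comm) (simp_all add: mult_assoc_dim BD_assoc Q12_def)
  finally show ?thesis .
qed

text \<open>Expand the square of DW = E - F, where F = EYG. Cyclicity turns the cross terms into the
  trace of GEEY, which is \<open>Q * Q23\<close>, and FF into the square of GEY, which is
  \<open>Q * Q12\<close>.\<close>

lemma trace_AK_square:
  "trace_mat (A * K * (A * K)) =
    trace_mat (D * B * (D * B)) - 2 * trace_mat (Q * Q23) + trace_mat (Q * Q12 * (Q * Q12))"
proof -
  define E where "E = D * B"
  \<comment> \<open>This \<open>G\<close> is a local abbreviation, unrelated to the residual
    projection \<open>G_mat\<close>.\<close>
  define G where "G = Q * transpose_mat Y * B"
  define F where "F = E * Y * G"
  have [simp]: "dim_row E = n" "dim_col E = n" "dim_row F = n" "dim_col F = n"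
    "dim_row G = p" "dim_col G = n"
    by (simp_all add: E_def F_def G_def)
  have DW: "D * W = E - F"
    by (simp add: W_def E_def F_def G_def mult_minus_dim mult_assoc_dim)
  have GEY: "G * (E * Y) = Q * Q12" and GEEY: "G * (E * (E * Y)) = Q * Q23"
    by (simp_all add: G_def E_def Q12_def Q23_def mult_assoc_dim BD_assoc)
  have "A * K * (A * K) = transpose_mat Z * (D * (W * (Z * transpose_mat Z)) * D * W * Z)"
    unfolding A_mult_K by (simp add: mult_assoc_dim)
  then have "trace_mat (A * K * (A * K)) = trace_mat (transpose_mat Z * (D * W * D * W * Z))"
    by (simp only: W_ZZ)
  also have "\<dots> = trace_mat (D * W * (D * (W * (Z * transpose_mat Z))))"
    by (subst trace_mult_comm) (simp_all add: mult_assoc_dim)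
  also have "\<dots> = trace_mat ((E - F) * (E - F))"
    by (simp only: W_ZZ DW)
  also have "\<dots> = trace_mat (E * E) - trace_mat (F * E) - (trace_mat (E * F) - trace_mat (F * F))"
    by (simp add: minus_mult_dim mult_minus_dim trace_minus)
  also have "trace_mat (F * E) = trace_mat (E * F)"
    by (rule trace_mult_comm) auto
  also have "trace_mat (E * F) = trace_mat ((E * (E * Y)) * G)"
    by (simp add: F_def mult_assoc_dim)
  also have "\<dots> = trace_mat (Q * Q23)"
    by (subst trace_mult_comm) (simp_all add: GEEY)
  also have "trace_mat (F * F) = trace_mat ((E * Y) * (G * (E * Y) * G))"
    by (simp add: F_def mult_assoc_dim)
  also have "\<dots> = trace_mat (G * (E * Y) * (G * (E * Y)))"
    by (subst trace_mult_comm) (simp_all add: mult_assoc_dim)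
  also have "\<dots> = trace_mat (Q * Q12 * (Q * Q12))"
    unfolding GEY ..
  finally show ?thesis by (simp add: E_def)
qed

end

text \<open>\<open>G - M M'\<close> is a symmetric idempotent of trace \<open>0\<close>, hence zero; no count of eigenspace
  dimensions is needed.\<close>

lemma residual_projection_decomposition:
  fixes X M :: "real mat"
  assumes X: "X \<in> carrier_mat n p" and pn: "p \<le> n"
    and R: "R \<in> carrier_mat p p" and RX: "R * (transpose_mat X * X) = 1\<^sub>m p"
    and G: "G = 1\<^sub>m n - X * R * transpose_mat X"
    and eig: "orthonormal_nonzero_eigenvectors n (n - p) G M"
  shows "transpose_mat X * M = 0\<^sub>m p (n - p)" and "M * transpose_mat M = G"
proof -
  have M: "M \<in> carrier_mat n (n - p)" and MM: "transpose_mat M * M = 1\<^sub>m (n - p)"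
    using eig by (auto simp: orthonormal_nonzero_eigenvectors_def)
  have d [simp]: "dim_row X = n" "dim_col X = p" "dim_row R = p" "dim_col R = p"
      "dim_row M = n" "dim_col M = n - p" "dim_row G = n" "dim_col G = n"
    using X M R by (auto simp: G)
  have XX: "transpose_mat X * X \<in> carrier_mat p p" using X by auto
  have XR: "transpose_mat X * X * R = 1\<^sub>m p"
    using mat_mult_left_right_inverse[OF R XX RX] .
  \<comment> \<open>Symmetry of the inverse: R' = R'(X'XR) = (X'XR)'R = R.\<close>
  have "transpose_mat R = transpose_mat R * (transpose_mat X * X * R)"
    unfolding XR by (simp add: right_mult_one_mat')
  also have "\<dots> = transpose_mat (transpose_mat X * X * R) * R"
    by (simp add: transpose_mult_dim mult_assoc_dim)
  also have "\<dots> = R" using R by (simp add: XR)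
  finally have Rt: "transpose_mat R = R" .
  have Gt: "transpose_mat G = G"
    unfolding G using X R
    by (subst transpose_minus[of _ n n]) (auto simp: transpose_mult_dim mult_assoc_dim Rt)
  have XG: "transpose_mat X * G = 0\<^sub>m p n"
  proof -
    have "transpose_mat X * G = transpose_mat X - (transpose_mat X * X * R) * transpose_mat X"
      using X by (simp add: G mult_minus_dim mult_assoc_dim right_mult_one_mat')
    then show ?thesis unfolding XR using X by simp
  qed
  have Gc: "G \<in> carrier_mat n n" by (rule carrier_matI) simp_all
  \<comment> \<open>X'G = 0 kills any eigenvector of \<open>G\<close> with eigenvalue \<mu> \<noteq>
    0: \<mu> X'v = X'Gv = 0.\<close>
  show XM: "transpose_mat X * M = 0\<^sub>m p (n - p)"
  proof (rule eq_matI)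
    fix i j assume "i < dim_row (0\<^sub>m p (n - p) :: real mat)" "j < dim_col (0\<^sub>m p (n - p) :: real mat)"
    then have ij: "i < p" "j < n - p" by auto
    then obtain \<mu> where \<mu>: "\<mu> \<noteq> 0" "G *\<^sub>v col M j = \<mu> \<cdot>\<^sub>v col M j"
      using eig by (auto simp: orthonormal_nonzero_eigenvectors_def eigenvector_def)
    have c: "col M j \<in> carrier_vec n" by (rule carrier_vecI) simp
    have "\<mu> \<cdot>\<^sub>v (transpose_mat X *\<^sub>v col M j) = transpose_mat X *\<^sub>v (G *\<^sub>v col M j)"
      using X c by (simp add: \<mu> mult_mat_vec[of _ p n])
    also have "\<dots> = (transpose_mat X * G) *\<^sub>v col M j"
      by (rule assoc_mult_mat_vec[symmetric, OF _ Gc c]) (simp, rule X)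
    also have "\<dots> = 0\<^sub>v p" unfolding XG using c by (intro eq_vecI) auto
    finally have "(\<mu> \<cdot>\<^sub>v (transpose_mat X *\<^sub>v col M j)) $ i = 0" using ij by simp
    then show "(transpose_mat X * M) $$ (i, j) = 0\<^sub>m p (n - p) $$ (i, j)"
      using ij \<mu>(1) by simp
  qed auto
  \<comment> \<open>So the eigenvalues in question are all 1.\<close>
  have GM: "G * M = M"
  proof -
    have "G * M = M - X * R * (transpose_mat X * M)"
      using M by (simp add: G minus_mult_dim mult_assoc_dim)
    then show ?thesis unfolding XM using X R M by (simp add: minus_zero_dim)
  qed
  have GG: "G * G = G"
  proof -
    have "G * G = G - X * R * (transpose_mat X * G)"
      by (subst (1) G) (simp add: minus_mult_dim mult_assoc_dim left_mult_one_mat')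
    then show ?thesis unfolding XG using X R by (simp add: minus_zero_dim)
  qed
  have MG: "transpose_mat M * G = transpose_mat M"
    using arg_cong[OF GM, of transpose_mat] by (simp add: transpose_mult_dim Gt)
  define E where "E = G - M * transpose_mat M"
  have "E = 0\<^sub>m n n"
  proof (rule symmetric_idempotent_trace_0)
    show "E \<in> carrier_mat n n" by (rule carrier_matI) (simp_all add: E_def)
    show "transpose_mat E = E"
      unfolding E_def using M
      by (subst transpose_minus[of _ n n]) (auto simp: transpose_mult_dim Gt)
    have "E * E = G * G - M * (transpose_mat M * G)
        - ((G * M) * transpose_mat M - M * (transpose_mat M * M) * transpose_mat M)"
      by (simp add: E_def minus_mult_dim mult_minus_dim mult_assoc_dim)
    also have "\<dots> = G - M * transpose_mat M"
      unfolding GG GM MG MM using M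
      by (auto simp: right_mult_one_mat')
    finally show "E * E = E" by (simp add: E_def)
    have "trace_mat (X * R * transpose_mat X) = trace_mat (R * (transpose_mat X * X))"
      by (subst mult_assoc_dim, simp, simp, subst trace_mult_comm) (simp_all add: mult_assoc_dim)
    then have "trace_mat G = real n - real p"
      by (simp add: G trace_minus trace_one RX)
    \<comment> \<open>\<open>pn\<close> turns the truncated \<open>n - p\<close> into a difference
      of reals.\<close>
    moreover have "trace_mat (M * transpose_mat M) = real n - real p"
      using pn by (subst trace_mult_comm) (simp_all add: MM trace_one of_nat_diff)
    ultimately show "trace_mat E = 0" by (simp add: E_def trace_minus)
  qed
  then have "(G - M * transpose_mat M) $$ (i, j) = 0" if "i < n" "j < n" for i j
    using that by (simp add: E_def)
  then show "M * transpose_mat M = G"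
    by (intro eq_matI) (simp_all del: index_mult_mat(1))
qed

section \<open>Signs of eigenvalues, diagonal forms, and the variance inequality\<close>

text \<open>Rayleigh quotient: for an eigenvector \<open>v\<close>, lam_j (v'v) is the sum of b_i
  (Zv)_i^2.\<close>

lemma ordered_eigenvalues_nonneg:
  fixes Z :: "real mat"
  assumes Z: "Z \<in> carrier_mat n m" and b: "\<And>i. i < n \<Longrightarrow> 0 \<le> b i"
    and lam: "ordered_eigenvalues m (transpose_mat Z * mat_diag n b * Z) lam" and j: "j < m"
  shows "0 \<le> lam j"
proof -
  let ?A = "transpose_mat Z * mat_diag n b * Z"
  have A: "?A \<in> carrier_mat m m" using Z by auto
  have "poly (char_poly ?A) (lam j) = 0"
    using lam j by (auto simp: ordered_eigenvalues_def poly_prod)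
  then obtain v where v: "v \<in> carrier_vec m" "v \<noteq> 0\<^sub>v m" "?A *\<^sub>v v = lam j \<cdot>\<^sub>v v"
    using eigenvalue_root_char_poly[OF A, of "lam j"] Z by (auto simp: eigenvalue_def eigenvector_def)
  have Zv: "Z *\<^sub>v v \<in> carrier_vec n" using Z v by auto
  have "0 \<le> (\<Sum>i<n. b i * ((Z *\<^sub>v v) $ i)\<^sup>2)"
    using b by (intro sum_nonneg) auto
  also have "\<dots> = v \<bullet> (?A *\<^sub>v v)"
    unfolding scalar_prod_congruence[OF Z mat_diag_dim v(1)] scalar_prod_mat_diag[OF Zv] ..
  also have "\<dots> = lam j * (v \<bullet> v)" using v by simp
  finally have "0 \<le> lam j * (v \<bullet> v)" .
  moreover have "0 < v \<bullet> v"
    using v conjugate_square_greater_0_vec[of v m] by simp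
  ultimately show ?thesis by (simp add: zero_le_mult_iff)
qed

text \<open>Packs the case split at the last index into one nonnegative diagonal \<open>e\<close>.
  For \<open>i < n - 1\<close>, monotonicity gives d_i \<ge> d_(n-2) > d_(n-1) = 0.\<close>

lemma spectral_decomp_D_plus:
  assumes "spectral_decomp n H P d" and n: "2 \<le> n"
  obtains e where "\<And>i. i < n \<Longrightarrow> 0 \<le> e i" "D_plus n d = mat_diag n e"
proof
  let ?e = "\<lambda>i. if i < n - 1 then inverse (d i) else 0"
  show "D_plus n d = mat_diag n ?e" by (simp add: D_plus_def)
  show "0 \<le> ?e i" if "i < n" for i
  proof (cases "i < n - 1")
    case True
    then have "d (n - 2) \<le> d i" "0 < d (n - 2)"
      using assms by (auto simp: spectral_decomp_def)
    then show ?thesis by simp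
  qed simp
qed

text \<open>Nonnegativity of \<open>e\<close> gives 1 + e_i/\<tau> \<ge> 1, so the entrywise
  reciprocals exist.\<close>

lemma B_mat_diag:
  assumes e: "\<And>i. i < n \<Longrightarrow> 0 \<le> e i" and D: "D_plus n d = mat_diag n e" and \<tau>: "0 < \<tau>"
  shows "B_mat n d \<tau> = mat_diag n (\<lambda>i. 1 / (1 + e i / \<tau>))"
    and "mat_diag n (\<lambda>i. 1 / (1 + e i / \<tau>)) * (1\<^sub>m n + inverse \<tau> \<cdot>\<^sub>m mat_diag n e) = 1\<^sub>m n"
proof -
  let ?B = "mat_diag n (\<lambda>i. 1 / (1 + e i / \<tau>))" and ?S = "1\<^sub>m n + inverse \<tau> \<cdot>\<^sub>m mat_diag n e"
  have S: "?S = mat_diag n (\<lambda>i. 1 + e i / \<tau>)"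
    by (rule eq_matI) (auto simp: mat_diag_def field_simps)
  have nz: "1 + e i / \<tau> \<noteq> 0" if "i < n" for i
    using e[OF that] \<tau> by (simp add: add_nonneg_eq_0_iff)
  have SB: "?S * ?B = 1\<^sub>m n" and BS: "?B * ?S = 1\<^sub>m n"
    unfolding S mat_diag_diag using nz by (auto simp: mat_diag_def intro!: eq_matI)
  show "?B * ?S = 1\<^sub>m n" by (fact BS)
  show "B_mat n d \<tau> = ?B"
    unfolding B_mat_def D by (rule inv_mat_eqI[OF _ _ SB]) auto
qed

text \<open>The difference is the sum of squared deviations from the mean.\<close>

lemma sum_squares_minus_mean_nonneg:
  fixes x :: "nat \<Rightarrow> real"
  shows "0 \<le> (\<Sum>i<m. (x i)\<^sup>2) - 1 / real m * (\<Sum>i<m. x i)\<^sup>2"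
proof (cases "m = 0")
  case False
  define s where "s = (\<Sum>i<m. x i)"
  have "0 \<le> (\<Sum>i<m. (x i - s / m)\<^sup>2)" by (intro sum_nonneg) auto
  also have "\<dots> = (\<Sum>i<m. (x i)\<^sup>2) - 2 * (s / m) * s + m * (s / m)\<^sup>2"
    by (simp add: power2_diff sum.distrib sum_subtractf s_def sum_distrib_left sum_divide_distrib ac_simps)
  also have "\<dots> = (\<Sum>i<m. (x i)\<^sup>2) - 1 / real m * s\<^sup>2"
    using False by (simp add: field_simps power2_eq_square)
  finally show ?thesis by (simp add: s_def)
qed simp

section \<open>Pointwise equality of the two priors\<close>

theorem theorem4p2:
  fixes n p :: nat
    and N :: "nat \<Rightarrow> nat set" and g :: "nat \<Rightarrow> nat \<Rightarrow> real"
    and X P M :: "real mat" and d lam :: "nat \<Rightarrow> real"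
  assumes X: "X \<in> carrier_mat n p" "p < n"
    and full_rank: "vec_space.rank n X = p"
    and ones: "\<exists>j<p. col X j = vec n (\<lambda>i. 1)"
    and nbh: "neighborhood_system n N g"
    and decomp: "spectral_decomp n (neighborhood_matrix n N g) P d"
    and M: "orthonormal_nonzero_eigenvectors n (n - p) (G_mat n X) M"
    and lam: "ordered_eigenvalues (n - p) (transpose_mat M * H_plus n P d * M) lam"
  shows "equivalent_priors (reference_prior_XD n p X P d) (reference_prior_eigen (n - p) lam)"
proof -
  interpret vec_space "TYPE(real)" n .
  define m where "m = n - p"
  \<comment> \<open>The column of ones makes \<open>p\<close> positive, and \<open>p < n\<close>
    does the rest; so \<open>n - 2\<close> is not truncated.\<close>
  have n2: "2 \<le> n" using ones X by auto
  obtain e where e: "\<And>i. i < n \<Longrightarrow> 0 \<le> e i" "D_plus n d = mat_diag n e"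
    using spectral_decomp_D_plus[OF decomp n2] by blast
  have P: "P \<in> carrier_mat n n" "transpose_mat P * P = 1\<^sub>m n" "P * transpose_mat P = 1\<^sub>m n"
    using decomp by (auto simp: spectral_decomp_def)
  have Mc: "M \<in> carrier_mat n m" and MM: "transpose_mat M * M = 1\<^sub>m m"
    using M by (auto simp: orthonormal_nonzero_eigenvectors_def m_def)
  have dims [simp]: "dim_row X = n" "dim_col X = p" "dim_row P = n" "dim_col P = n"
    "dim_row M = n" "dim_col M = m"
    using X P Mc by auto
  have X_inj: "v = 0\<^sub>v p" if "v \<in> carrier_vec p" "X *\<^sub>v v = 0\<^sub>v n" for v
    using full_rank_injective[OF X(1) full_rank that] .

  define R where "R = inv_mat (transpose_mat X * X)"
  have R: "R \<in> carrier_mat p p" "R * (transpose_mat X * X) = 1\<^sub>m p"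
  proof -
    \<comment> \<open>Unit weights bring X'X into the shape of
      \<open>congruence_diag_inverse\<close>.\<close>
    have c: "transpose_mat X * X = transpose_mat X * mat_diag n (\<lambda>_. 1) * X"
      using X by (simp add: right_mult_one_mat')
    show "R \<in> carrier_mat p p" "R * (transpose_mat X * X) = 1\<^sub>m p"
      unfolding R_def c by (rule congruence_diag_inverse[OF X(1) _ X_inj]; simp)+
  qed
  have G: "G_mat n X = 1\<^sub>m n - X * R * transpose_mat X"
    by (simp add: G_mat_def R_def)
  note proj = residual_projection_decomposition[OF X(1) less_imp_le[OF X(2)] R G M, folded m_def]

  define Y where "Y = transpose_mat P * X"
  define Z where "Z = transpose_mat P * M"
  have YZdims [simp]: "dim_row Y = n" "dim_col Y = p" "dim_row Z = n" "dim_col Z = m"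
    by (simp_all add: Y_def Z_def)
  have Y: "Y \<in> carrier_mat n p" and Z: "Z \<in> carrier_mat n m"
    by (rule carrier_matI; simp)+
  \<comment> \<open>Cancels the orthogonal \<open>P\<close> inside right-nested products.\<close>
  have PP: "P * (transpose_mat P * C) = C" if "dim_row C = n" for C
  proof -
    have "P * (transpose_mat P * C) = (P * transpose_mat P) * C"
      using that by (simp add: mult_assoc_dim)
    then show ?thesis using that by (simp add: P left_mult_one_mat')
  qed
  have Y_inj: "v = 0\<^sub>v p" if v: "v \<in> carrier_vec p" "Y *\<^sub>v v = 0\<^sub>v n" for v
  proof -
    have "X *\<^sub>v v = (P * Y) *\<^sub>v v" by (simp add: Y_def PP)
    also have "\<dots> = P *\<^sub>v (Y *\<^sub>v v)" using assoc_mult_mat_vec[OF P(1) Y v(1)] .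
    also have "\<dots> = 0\<^sub>v n" unfolding v(2) by (rule eq_vecI) (simp_all add: scalar_prod_def)
    finally show ?thesis using X_inj v by blast
  qed
  have A: "transpose_mat M * H_plus n P d * M = transpose_mat Z * mat_diag n e * Z"
    by (simp add: H_plus_def e(2) Z_def transpose_mult_dim mult_assoc_dim mat_diag_def)
  have lam_nonneg: "0 \<le> lam j" if "j < m" for j
    by (rule ordered_eigenvalues_nonneg[OF Z _ lam[folded m_def, unfolded A] that]) (rule e(1))
  have cp: "char_poly (transpose_mat Z * mat_diag n e * Z) = (\<Prod>i<m. [:- lam i, 1:])"
    using lam unfolding A m_def ordered_eigenvalues_def by blast

  have XD: "reference_prior_XD n p X P d \<tau> = reference_prior_eigen m lam \<tau>" if \<tau>: "0 < \<tau>" for \<tau>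
  proof -
    define b where "b = (\<lambda>i. 1 / (1 + e i / \<tau>))"
    define D where "D = mat_diag n e"
    define B where "B = mat_diag n b"
    define S where "S = 1\<^sub>m n + inverse \<tau> \<cdot>\<^sub>m D"
    define Q where "Q = inv_mat (transpose_mat Y * B * Y)"
    have b: "0 < b i" if "i < n" for i
      using e(1)[OF that] \<tau> by (simp add: b_def add_pos_nonneg)
    have D: "D \<in> carrier_mat n n" and B: "B \<in> carrier_mat n n"
      by (simp_all add: D_def B_def)
    have S: "S \<in> carrier_mat n n" using D by (simp add: S_def)
    have Bm: "B_mat n d \<tau> = B" and BS: "B * S = 1\<^sub>m n"
      using B_mat_diag[where e = e, OF e \<tau>] by (simp_all add: B_def b_def S_def D_def)
    have Q: "Q \<in> carrier_mat p p" "transpose_mat Y * B * Y * Q = 1\<^sub>m p"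
        "Q * (transpose_mat Y * B * Y) = 1\<^sub>m p"
      unfolding Q_def B_def by (rule congruence_diag_inverse[OF Y b Y_inj]; assumption)+
    interpret F: complementary_frames n p m Y Z R S B D Q
    proof
      show "transpose_mat Z * Z = 1\<^sub>m m"
        by (simp add: Z_def transpose_mult_dim mult_assoc_dim PP MM)
      show "transpose_mat Y * Z = 0\<^sub>m p m"
        by (simp add: Y_def Z_def transpose_mult_dim mult_assoc_dim PP proj(1))
      have XR: "X * R * transpose_mat X \<in> carrier_mat n n" using X R by simp
      \<comment> \<open>Conjugation by \<open>P\<close> reduces the claim to MM' + XRX' = 1, which
        holds because MM' = G = 1 - XRX'.\<close>
      have "Z * transpose_mat Z + Y * R * transpose_mat Y
          = transpose_mat P * (M * transpose_mat M) * P + transpose_mat P * (X * R * transpose_mat X) * P"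
        using R by (simp add: Y_def Z_def transpose_mult_dim mult_assoc_dim)
      also have "\<dots> = transpose_mat P * (M * transpose_mat M + X * R * transpose_mat X) * P"
        using P XR Mc
        by (simp add: mult_add_distrib_mat[of _ n n _ n] add_mult_distrib_mat[of _ n n _ _ n])
      also have "M * transpose_mat M + X * R * transpose_mat X = 1\<^sub>m n"
        unfolding proj(2) G using XR by (intro eq_matI) auto
      finally show "Z * transpose_mat Z + Y * R * transpose_mat Y = 1\<^sub>m n"
        using P by simp
      show "B * D = D * B" by (simp add: B_def D_def mult.commute)
    qed (fact Y Z R S B D BS Q)+
    have FA: "F.A = transpose_mat Z * mat_diag n e * Z" unfolding F.A_def by (simp only: D_def)
    \<comment> \<open>Z'Z = 1 preserves the identity under compression, so \<open>F.K\<close> is the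
      inverse of 1 + cA with c = 1/\<tau>, as \<open>trace_resolvent\<close> requires.\<close>
    have S_compressed: "transpose_mat Z * S * Z = 1\<^sub>m m + inverse \<tau> \<cdot>\<^sub>m F.A"
    proof -
      have "transpose_mat Z * S * Z = transpose_mat Z * Z + inverse \<tau> \<cdot>\<^sub>m (transpose_mat Z * D * Z)"
        using Z D unfolding S_def
        by (simp add: mult_add_distrib_mat[of _ m n _ n] add_mult_distrib_mat[of _ m n _ _ m]
            mult_smult_distrib[of _ m n _ n] mult_smult_assoc_mat[of _ m n _ m])
      then show ?thesis by (simp add: F.ZZ F.A_def)
    qed
    have pos: "0 < \<tau> + lam j" if "j < m" for j
      using lam_nonneg[OF that] \<tau> by simp
    have nz: "1 + inverse \<tau> * lam j \<noteq> 0" if "j < m" for j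
      using pos[OF that] \<tau> by (simp add: field_simps)
    \<comment> \<open>The extracted \<tau> becomes a factor \<tau>^2 under the root, which lowers
      the prefactor from 1/\<tau>^2 to 1/\<tau>.\<close>
    have frac: "lam j / (1 + inverse \<tau> * lam j) = \<tau> * (lam j / (\<tau> + lam j))" if "j < m" for j
      using pos[OF that] nz[OF that] \<tau> by (simp add: field_simps)
    note tr = trace_resolvent[OF F.carriers(1) cp[folded FA] F.carriers(2)
        F.K_inverse[unfolded S_compressed] nz]
    have trAK: "trace_mat (F.A * F.K) = \<tau> * (\<Sum>j<m. lam j / (\<tau> + lam j))"
      by (subst tr(1)) (simp_all add: frac sum_distrib_left)
    have trAK2: "trace_mat (F.A * F.K * (F.A * F.K)) = \<tau>\<^sup>2 * (\<Sum>j<m. (lam j / (\<tau> + lam j))\<^sup>2)"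
    proof -
      have "trace_mat (F.A * F.K * (F.A * F.K)) = (\<Sum>j<m. (lam j / (1 + inverse \<tau> * lam j))\<^sup>2)"
        by (rule tr(2))
      also have "\<dots> = (\<Sum>j<m. \<tau>\<^sup>2 * (lam j / (\<tau> + lam j))\<^sup>2)"
        by (intro sum.cong refl) (simp only: frac power_mult_distrib lessThan_iff)
      finally show ?thesis by (simp only: sum_distrib_left)
    qed
    have Q01: "Q_mat n d P X 0 1 \<tau> = transpose_mat Y * B * Y"
      using Y D B by (simp add: Q_mat_def Bm e(2) flip: D_def Y_def)
    have Q12: "Q_mat n d P X 1 2 \<tau> = F.Q12"
      using Y D B by (simp add: Q_mat_def F.Q12_def Bm e(2) pow_mat_2[OF B] flip: D_def Y_def)
    have Q23: "Q_mat n d P X 2 3 \<tau> = F.Q23"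
      by (simp add: Q_mat_def F.Q23_def Bm e(2) pow_mat_2[OF D] pow_mat_3[OF B]
          flip: D_def Y_def)
    have QQ: "Q * F.Q12 \<in> carrier_mat p p" by (rule carrier_matI) (simp_all add: F.Q12_def)
    have DB: "D * B \<in> carrier_mat n n" using D B by simp
    define V where "V = (\<Sum>j<m. (lam j / (\<tau> + lam j))\<^sup>2) - 1 / real m * (\<Sum>j<m. lam j / (\<tau> + lam j))\<^sup>2"
    have "trace_mat ((D * B) ^\<^sub>m 2) + trace_mat ((Q * F.Q12) ^\<^sub>m 2) - 2 * trace_mat (Q * F.Q23)
        - 1 / real m * (trace_mat (Q * F.Q12) - trace_mat (D * B))\<^sup>2
      = trace_mat (F.A * F.K * (F.A * F.K)) - 1 / real m * (trace_mat (F.A * F.K))\<^sup>2"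
      unfolding pow_mat_2[OF QQ] pow_mat_2[OF DB] F.trace_AK F.trace_AK_square
      by (simp add: power2_commute)
    also have "\<dots> = \<tau>\<^sup>2 * V"
      unfolding trAK trAK2 V_def by (simp add: algebra_simps power_mult_distrib)
    finally have "reference_prior_XD n p X P d \<tau> = 1 / \<tau>\<^sup>2 * sqrt (\<tau>\<^sup>2 * V)"
      unfolding reference_prior_XD_def Let_def Q01 Q12 Q23 Bm e(2)
      by (simp add: Q_def D_def m_def)
    also have "\<dots> = 1 / \<tau> * sqrt V"
      using \<tau> by (simp add: real_sqrt_mult power2_eq_square)
    finally show ?thesis by (simp add: reference_prior_eigen_def V_def)
  qed
  \<comment> \<open>Through \<open>XD\<close> this also covers the first prior.\<close>
  have nonneg: "0 \<le> reference_prior_eigen m lam \<tau>" if "0 < \<tau>" for \<tau>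
    using that sum_squares_minus_mean_nonneg[of "\<lambda>j. lam j / (\<tau> + lam j)" m]
    by (simp add: reference_prior_eigen_def)
  show ?thesis
    unfolding equivalent_priors_def m_def[symmetric] using XD nonneg
    by (auto intro!: exI[of _ 1])
qed

end
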